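(* Let $K$ be a field of characteristic zero, let $k$ be a positive integer, let $A\in M_k(K)$, and let \[ T^k-s_1T^{k-1}+s_2T^{k-2}+\cdots+(-1)^ks_k \] denote its characteristic polynomial. For integers $m\ge 0$ define \[ a(m)=\sum_{2i_2+3i_3+\cdots+ki_k\le m} c(i_2,\dots,i_k,m)\, s_1^{\,m-2i_2-3i_3-\cdots-ki_k}(-s_2)^{i_2}s_3^{i_3}\cdots\big((-1)^{k-1}s_k\big)^{i_k}, \] where \[ c(i_2,\dots,i_k,m)=\frac{(m-i_2-2i_3-\cdots-(k-1)i_k)!}{i_2!\cdots i_k!\,(m-2i_2-3i_3-\cdots-ki_k)!}. \] Then, for all $n\ge k$, one has \[ A^n=b_{k-1}A^{k-1}+b_{k-2}A^{k-2}+\cdots+b_0 I, \] where \begin{align*} b_{k-1}&=a(n-k+1),\\ b_{k-2}&=a(n-k+2)-s_1a(n-k+1),\\ &\ \,\vdots\\ b_1&=a(n-1)-s_1a(n-2)+\cdots+(-1)^{k-2}s_{k-2}a(n-k+1),\\ b_0&=a(n)-s_1a(n-1)+\cdots+(-1)^{k-1}s_{k-1}a(n-k+1)=(-1)^{k-1}s_ka(n-k); \end{align*} that is, $b_{k-1-j}=\sum_{i=0}^{j}(-1)^i s_i\,a(n-k+1+j-i)$ for $0\le j\le k-1$ with $s_0=1$, and moreover $b_0=(-1)^{k-1}s_k a(n-k)$.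
   Context: $M_k(K)$ is the ring of $k\times k$ matrices over $K$ and $I$ the identity matrix. The characteristic polynomial is $\det(TI-A)$. The sum defining $a(m)$ is over all tuples $(i_2,\dots,i_k)$ of nonnegative integers with $2i_2+\cdots+ki_k\le m$. The convention $0^0=1$ is used in powers, so $a(0)=1$. *)

theory Defs
  imports "Jordan_Normal_Form.Char_Poly" "HOL-Library.FuncSet"
begin

(* The tuples (i_2, ..., i_k) of naturals with 2 i_2 + ... + k i_k \<le> m. Extensionality makes
   functions on {2..k} represent tuples uniquely; for k = 1 there is exactly one (empty) tuple. *)
definition weighted_tuples :: "nat \<Rightarrow> nat \<Rightarrow> (nat \<Rightarrow> nat) set" where
  "weighted_tuples k m = {i \<in> {2..k} \<rightarrow>\<^sub>E UNIV. (\<Sum>j=2..k. j * i j) \<le> m}"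

(* On weighted_tuples k m the natural-number subtractions below do not truncate. *)
definition tuple_coeff :: "nat \<Rightarrow> (nat \<Rightarrow> nat) \<Rightarrow> nat \<Rightarrow> 'a :: field_char_0" where
  "tuple_coeff k i m =
     fact (m - (\<Sum>j=2..k. (j - 1) * i j)) /
     ((\<Prod>j=2..k. fact (i j)) * fact (m - (\<Sum>j=2..k. j * i j)))"

definition a_seq :: "nat \<Rightarrow> (nat \<Rightarrow> 'a :: field_char_0) \<Rightarrow> nat \<Rightarrow> 'a" where
  "a_seq k s m = (\<Sum>i \<in> weighted_tuples k m.
     tuple_coeff k i m * s 1 ^ (m - (\<Sum>j=2..k. j * i j)) *
     (\<Prod>j=2..k. ((-1) ^ (j - 1) * s j) ^ i j))"

(* b_l for the n-th power, written with l = k - 1 - j; meant for l < k \<le> n and s 0 = 1. *)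
definition b_coeff :: "nat \<Rightarrow> (nat \<Rightarrow> 'a :: field_char_0) \<Rightarrow> nat \<Rightarrow> nat \<Rightarrow> 'a" where
  "b_coeff k s n l = (let j = k - 1 - l in
     \<Sum>i=0..j. (-1) ^ i * s i * a_seq k s (n - k + 1 + j - i))"

lemma finite_weighted_tuples: "finite (weighted_tuples k m)"
proof (rule finite_subset)
  show "weighted_tuples k m \<subseteq> {2..k} \<rightarrow>\<^sub>E {..m}"
  proof
    fix i assume "i \<in> weighted_tuples k m"
    then have ext: "i \<in> {2..k} \<rightarrow>\<^sub>E UNIV" and le: "(\<Sum>j=2..k. j * i j) \<le> m"
      by (auto simp: weighted_tuples_def)
    have "i j \<le> m" if j: "j \<in> {2..k}" for j
    proof -
      have "i j \<le> j * i j" using j by simp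
      also have "\<dots> \<le> (\<Sum>j=2..k. j * i j)" using j by (intro member_le_sum) auto
      finally show ?thesis using le by simp
    qed
    with ext show "i \<in> {2..k} \<rightarrow>\<^sub>E {..m}" by (auto simp: PiE_def)
  qed
qed (simp add: finite_PiE)

end

theory Submission
  imports Defs
begin

text \<open>
  By Cayley--Hamilton every entry of the powers of \<open>A\<close> satisfies the linear recurrence with
  coefficients \<open>c i = (-1) ^ i * s i\<close>. Adding the coordinate \<open>i 1 = m - 2 i 2 - \<dots> - k i k\<close>
  turns \<open>a m\<close> into the sum of all multinomial terms of weight \<open>m\<close> in the variables \<open>- c j\<close>, so
  \<open>a\<close> is the inverse of \<open>c\<close> under convolution. The coefficients \<open>b\<close> are partial convolutions of
  \<open>c\<close> and \<open>a\<close>, and an induction on \<open>n\<close>, started at \<open>n = k - 1\<close>, shows that they expand any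
  solution of the recurrence in its first \<open>k\<close> values.
\<close>

section \<open>Cayley-Hamilton for the entries of matrix powers\<close>

text \<open>Matrices of fixed size are summed in the abelian group \<open>module_mat\<close>;
  passing to entries turns such sums into ordinary ring sums, so that a scalar recurrence suffices
  for the matrix identity.\<close>

lemma index_finsum_module_mat:
  assumes "finite F" and "\<And>l. l \<in> F \<Longrightarrow> M l \<in> carrier_mat nr nc" and "r < nr" "c < nc"
  shows "finsum (module_mat TYPE('a :: comm_ring_1) nr nc) M F $$ (r, c) = (\<Sum>l\<in>F. M l $$ (r, c))"
  using assms(1,2)
proof (induction F rule: finite_induct)
  case empty
  interpret abelian_group "module_mat TYPE('a) nr nc" by (rule abelian_group_mat)
  show ?case using assms(3,4) by (simp add: module_mat_simps)
next
  case (insert l F)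
  interpret abelian_group "module_mat TYPE('a) nr nc" by (rule abelian_group_mat)
  have "M \<in> F \<rightarrow> carrier (module_mat TYPE('a) nr nc)" "M l \<in> carrier (module_mat TYPE('a) nr nc)"
    using insert by (auto simp: module_mat_simps)
  then have "finsum (module_mat TYPE('a) nr nc) M (insert l F)
      = M l + finsum (module_mat TYPE('a) nr nc) M F"
    and "finsum (module_mat TYPE('a) nr nc) M F \<in> carrier_mat nr nc"
    using insert.hyps finsum_closed[of M F] by (simp_all add: module_mat_simps)
  with insert assms(3,4) show ?case by simp
qed

text \<open>Comparing coefficients of T^0 and T^(t+1) in (T I - A) adj(T I - A) =
  \<open>char_poly A\<close> I. The matrix \<open>B t\<close> is the coefficient of T^t of the
  adjugate; the factor T accounts for the index shift from \<open>Suc t\<close> to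
  \<open>t\<close>.\<close>

lemma char_poly_adj_mat_coeff:
  fixes A :: "'a :: comm_ring_1 mat"
  assumes A: "A \<in> carrier_mat k k"
  defines "B \<equiv> \<lambda>t. map_mat (\<lambda>p. coeff p t) (adj_mat (char_poly_matrix A))"
  shows "coeff (char_poly A) 0 \<cdot>\<^sub>m 1\<^sub>m k = - (A * B 0)"
    and "coeff (char_poly A) (Suc t) \<cdot>\<^sub>m 1\<^sub>m k = B t - A * B (Suc t)"
proof -
  let ?C = "char_poly_matrix A" and ?D = "adj_mat (char_poly_matrix A)"
  have C: "?C \<in> carrier_mat k k" using A by simp
  note D = adj_mat(1)[OF C]
  have entry: "(if i = c then char_poly A else 0)
      = [:0, 1:] * ?D $$ (i, c) - (\<Sum>j<k. [:A $$ (i, j):] * ?D $$ (j, c))"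
    if ic: "i < k" "c < k" for i c
  proof -
    have "(if i = c then char_poly A else 0) = (?C * ?D) $$ (i, c)"
      using ic by (simp add: adj_mat(2)[OF C] char_poly_def)
    also have "\<dots> = (\<Sum>j<k. ?C $$ (i, j) * ?D $$ (j, c))"
      using ic C D by (simp add: scalar_prod_def atLeast0LessThan)
    also have "\<dots> = (\<Sum>j<k. (if i = j then [:0, 1:] * ?D $$ (j, c) else 0)
                         - [:A $$ (i, j):] * ?D $$ (j, c))"
      using ic A by (intro sum.cong) (auto simp: char_poly_matrix_def algebra_simps)
    also have "\<dots> = [:0, 1:] * ?D $$ (i, c) - (\<Sum>j<k. [:A $$ (i, j):] * ?D $$ (j, c))"
      using ic by (simp add: sum_subtractf)
    finally show ?thesis .
  qed
  have AB: "(A * B t) $$ (i, c) = (\<Sum>j<k. A $$ (i, j) * coeff (?D $$ (j, c)) t)"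
    if "i < k" "c < k" for i c t
    using that A D by (simp add: B_def scalar_prod_def atLeast0LessThan)
  have BD: "B t $$ (i, c) = coeff (?D $$ (i, c)) t" if "i < k" "c < k" for i c t
    using that D by (simp add: B_def)
  have BC: "B t \<in> carrier_mat k k" for t
    using D by (simp add: B_def)
  show "coeff (char_poly A) 0 \<cdot>\<^sub>m 1\<^sub>m k = - (A * B 0)"
  proof (rule eq_matI)
    fix i c assume "i < dim_row (- (A * B 0))" "c < dim_col (- (A * B 0))"
    then have ic: "i < k" "c < k" using A BC[of 0] by auto
    have "coeff (if i = c then char_poly A else 0) 0 = - (A * B 0) $$ (i, c)"
      using ic by (subst entry[OF ic]) (simp add: AB coeff_sum)
    then show "(coeff (char_poly A) 0 \<cdot>\<^sub>m 1\<^sub>m k) $$ (i, c) = (- (A * B 0)) $$ (i, c)"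
      using ic A BC[of 0] by (auto split: if_splits)
  qed (use A BC[of 0] in auto)
  show "coeff (char_poly A) (Suc t) \<cdot>\<^sub>m 1\<^sub>m k = B t - A * B (Suc t)"
  proof (rule eq_matI)
    fix i c assume "i < dim_row (B t - A * B (Suc t))" "c < dim_col (B t - A * B (Suc t))"
    then have ic: "i < k" "c < k" using A BC[of "Suc t"] by auto
    have "coeff (if i = c then char_poly A else 0) (Suc t)
        = B t $$ (i, c) - (A * B (Suc t)) $$ (i, c)"
      by (subst entry[OF ic]) (simp add: AB[OF ic] BD[OF ic] coeff_sum)
    then show "(coeff (char_poly A) (Suc t) \<cdot>\<^sub>m 1\<^sub>m k) $$ (i, c) = (B t - A * B (Suc t)) $$ (i, c)"
      using ic A BC[of "Suc t"] BC[of t] by (auto split: if_splits)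
  qed (use A BC[of "Suc t"] in auto)
qed

text \<open>Multiplying the \<open>t\<close>-th coefficient
  of \<open>(T I - A) adj (T I - A) = char_poly A\<close> by \<open>A ^ (N + t)\<close> makes the sum telescope.\<close>
lemma cayley_hamilton_entry:
  fixes A :: "'a :: comm_ring_1 mat"
  assumes A: "A \<in> carrier_mat k k" and rc: "r < k" "c < k"
  shows "(\<Sum>t\<le>degree (char_poly A). coeff (char_poly A) t * (A ^\<^sub>m (N + t)) $$ (r, c)) = 0"
proof -
  let ?p = "char_poly A"
  define B where "B = (\<lambda>t. map_mat (\<lambda>p. coeff p t) (adj_mat (char_poly_matrix A)))"
  have B: "B t \<in> carrier_mat k k" for t
    using adj_mat(1)[of "char_poly_matrix A" k] A by (simp add: B_def)
  have coeff_B: "coeff ?p 0 \<cdot>\<^sub>m 1\<^sub>m k = - (A * B 0)"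
    "coeff ?p (Suc t) \<cdot>\<^sub>m 1\<^sub>m k = B t - A * B (Suc t)" for t
    unfolding B_def by (rule char_poly_adj_mat_coeff[OF A])+
  have P: "A ^\<^sub>m t \<in> carrier_mat k k" for t using A by simp
  have AB: "A * B t \<in> carrier_mat k k" for t using A B by simp
  have PS: "A ^\<^sub>m t * (A * C) = A ^\<^sub>m Suc t * C" if "C \<in> carrier_mat k k" for t C
    using assoc_mult_mat[OF P A that] by simp
  have coeff_pow: "coeff ?p t \<cdot>\<^sub>m A ^\<^sub>m n = A ^\<^sub>m n * (coeff ?p t \<cdot>\<^sub>m 1\<^sub>m k)" for t n
    using mult_smult_distrib[OF P one_carrier_mat] right_mult_one_mat[OF P] by simp
  have telescope: "(\<Sum>t\<le>d. coeff ?p t * (A ^\<^sub>m (N + t)) $$ (r, c))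
      = - (A ^\<^sub>m (N + Suc d) * B d) $$ (r, c)" for d
  proof (induction d)
    case 0
    have "coeff ?p 0 \<cdot>\<^sub>m A ^\<^sub>m N = A ^\<^sub>m N * - (A * B 0)"
      by (simp only: coeff_pow coeff_B(1))
    also have "\<dots> = - (A ^\<^sub>m Suc N * B 0)"
      using uminus_mult_right_mat[of "A * B 0" "A ^\<^sub>m N"] carrier_matD[OF P] carrier_matD[OF AB] PS[OF B, of N 0] by simp
    finally have "(coeff ?p 0 \<cdot>\<^sub>m A ^\<^sub>m N) $$ (r, c) = (- (A ^\<^sub>m Suc N * B 0)) $$ (r, c)" by simp
    then show ?case using rc A B[of 0] P[of N] P[of "Suc N"] by (simp del: pow_mat.simps)
  next
    case (Suc d)
    have "coeff ?p (Suc d) \<cdot>\<^sub>m A ^\<^sub>m (N + Suc d) = A ^\<^sub>m (N + Suc d) * (B d - A * B (Suc d))"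
      by (simp only: coeff_pow coeff_B(2))
    also have "\<dots> = A ^\<^sub>m (N + Suc d) * B d - A ^\<^sub>m (N + Suc (Suc d)) * B (Suc d)"
      by (simp only: mult_minus_distrib_mat[OF P B AB] PS[OF B] add_Suc_right)
    finally have "(coeff ?p (Suc d) \<cdot>\<^sub>m A ^\<^sub>m (N + Suc d)) $$ (r, c)
      = (A ^\<^sub>m (N + Suc d) * B d - A ^\<^sub>m (N + Suc (Suc d)) * B (Suc d)) $$ (r, c)" by simp
    moreover have "A ^\<^sub>m (N + Suc d) * B d \<in> carrier_mat k k"
      "A ^\<^sub>m (N + Suc (Suc d)) * B (Suc d) \<in> carrier_mat k k"
      by (rule mult_carrier_mat[OF P B])+
    ultimately have "coeff ?p (Suc d) * (A ^\<^sub>m (N + Suc d)) $$ (r, c)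
      = (A ^\<^sub>m (N + Suc d) * B d) $$ (r, c) - (A ^\<^sub>m (N + Suc (Suc d)) * B (Suc d)) $$ (r, c)"
      using rc carrier_matD[OF P[of "N + Suc d"]]
      by (metis index_minus_mat(1) index_smult_mat(1) carrier_matD)
    with Suc.IH show ?case by (simp del: pow_mat.simps add_Suc_right)
  qed
  \<comment> \<open>Any \<open>d\<close> beyond the degrees of \<open>char_poly A\<close> and of all
    adjugate entries works: then \<open>B d\<close> is zero, which kills the telescoped remainder,
    and the summands past the degree vanish as well. Sums of degrees serve as a crude
    maximum.\<close>
  define d where "d = degree ?p + (\<Sum>i<k. \<Sum>j<k. degree (adj_mat (char_poly_matrix A) $$ (i, j))) + 1"
  have "coeff (adj_mat (char_poly_matrix A) $$ (i, j)) d = 0" if ij: "i < k" "j < k" for i j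
  proof (rule coeff_eq_0)
    have "degree (adj_mat (char_poly_matrix A) $$ (i, j))
        \<le> (\<Sum>j<k. degree (adj_mat (char_poly_matrix A) $$ (i, j)))"
      using ij by (intro member_le_sum) auto
    also have "\<dots> \<le> (\<Sum>i<k. \<Sum>j<k. degree (adj_mat (char_poly_matrix A) $$ (i, j)))"
      using ij by (intro member_le_sum[where f = "\<lambda>i. \<Sum>j<k. degree (adj_mat (char_poly_matrix A) $$ (i, j))"]) auto
    finally show "degree (adj_mat (char_poly_matrix A) $$ (i, j)) < d" by (simp add: d_def)
  qed
  then have "B d = 0\<^sub>m k k"
    using adj_mat(1)[of "char_poly_matrix A" k] A by (intro eq_matI) (auto simp: B_def)
  then have "(\<Sum>t\<le>d. coeff ?p t * (A ^\<^sub>m (N + t)) $$ (r, c)) = 0"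
    using telescope[of d] rc right_mult_zero_mat[OF P, of "N + Suc d" k] by (simp del: pow_mat.simps add_Suc_right)
  moreover have "(\<Sum>t\<le>d. coeff ?p t * (A ^\<^sub>m (N + t)) $$ (r, c))
      = (\<Sum>t\<le>degree ?p. coeff ?p t * (A ^\<^sub>m (N + t)) $$ (r, c))"
    by (rule sum.mono_neutral_right) (auto simp: d_def coeff_eq_0)
  ultimately show ?thesis by simp
qed

section \<open>Solutions of a linear recurrence in terms of their first \<open>k\<close>
  values\<close>

text \<open>The shifted sequence satisfies the same recurrence, so the induction hypothesis expands
  \<open>u (k - 1 + Suc m)\<close> in \<open>u 1\<close>, ..., \<open>u k\<close>. Only
  \<open>u k\<close> lies outside the first \<open>k\<close> values, and the recurrence eliminates
  it.\<close>

lemma linear_recurrence_expansion: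
  fixes u a c :: "nat \<Rightarrow> 'a :: comm_ring_1"
  assumes k: "k \<ge> 1" and c0: "c 0 = 1" and a0: "a 0 = 1"
    and a: "\<And>m. m \<ge> 1 \<Longrightarrow> (\<Sum>i\<le>min k m. c i * a (m - i)) = 0"
    and u: "\<And>N. (\<Sum>i\<le>k. c i * u (N + k - i)) = 0"
  shows "u (k - 1 + m) = (\<Sum>j<k. (\<Sum>i\<le>j. c i * a (m + j - i)) * u (k - 1 - j))"
  using u
proof (induction m arbitrary: u)
  case 0
  \<comment> \<open>For \<open>m = 0\<close> and \<open>j < k\<close> the inner sum is the full
    convolution at \<open>j\<close>, which vanishes unless \<open>j = 0\<close>.\<close>
  have "(\<Sum>i\<le>j. c i * a (0 + j - i)) = (if j = 0 then 1 else 0)" if "j < k" for j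
    using that a[of j] c0 a0 by (auto simp: min_def)
  then have "(\<Sum>j<k. (\<Sum>i\<le>j. c i * a (0 + j - i)) * u (k - 1 - j))
      = (\<Sum>j<k. if j = 0 then u (k - 1) else 0)"
    by (intro sum.cong) auto
  also have "\<dots> = u (k - 1)" using k by simp
  finally show ?case by simp
next
  case (Suc m)
  define b where "b m j = (\<Sum>i\<le>j. c i * a (m + j - i))" for m j
  obtain k' where k': "k = Suc k'" using k by (cases k) auto
  \<comment> \<open>The two partial convolutions differ only in the summand
    \<open>i = Suc j\<close>.\<close>
  have shift: "b m (Suc j) = b (Suc m) j + c (Suc j) * a m" for j
    by (simp add: b_def)
  \<comment> \<open>The convolution at \<open>m + k\<close> vanishes, and
    \<open>b (Suc m) k'\<close> lacks only its summand \<open>i = k\<close>. This gives the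
    coefficient of \<open>u 0\<close>, which arises solely from eliminating
    \<open>u k\<close>.\<close>
  have last: "b (Suc m) k' = - (c k * a m)"
    using a[of "m + k"] k' by (simp add: b_def eq_neg_iff_add_eq_0)
  have top: "u k = - (\<Sum>i<k. c (Suc i) * u (k - Suc i))"
    using Suc.prems[of 0] c0 by (simp add: lessThan_Suc_atMost[symmetric] sum.lessThan_Suc_shift
        eq_neg_iff_add_eq_0 del: sum.lessThan_Suc)
  have "u (k - 1 + Suc m) = (\<Sum>j<k. b m j * u (k - j))"
    using Suc.IH[of "\<lambda>t. u (Suc t)"] Suc.prems[of "Suc _"] k'
    by (simp add: b_def Suc_diff_le)
  also have "\<dots> = a m * u k + (\<Sum>j<k'. b m (Suc j) * u (k' - j))"
    unfolding k' by (subst sum.lessThan_Suc_shift) (simp add: b_def c0)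
  also have "\<dots> = (\<Sum>j<k'. (b m (Suc j) - c (Suc j) * a m) * u (k' - j)) - c k * a m * u 0"
    by (simp add: top[unfolded k'] k' sum_subtractf algebra_simps sum_distrib_left)
  also have "\<dots> = (\<Sum>j<k. b (Suc m) j * u (k - 1 - j))"
    unfolding k' using last k' by (simp add: shift)
  finally show ?case by (simp add: b_def)
qed

section \<open>The sequence a as a sum of multinomial terms\<close>

definition weighted_partitions :: "nat \<Rightarrow> nat \<Rightarrow> (nat \<Rightarrow> nat) set" where
  "weighted_partitions k m = {i \<in> {1..k} \<rightarrow>\<^sub>E UNIV. (\<Sum>j=1..k. j * i j) = m}"

text \<open>Summed over \<open>weighted_partitions k m\<close>, these terms give the coefficient of
  T^m in the power series 1 / (1 - x_1 T - ... - x_k T^k).\<close>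

definition multinomial_term :: "nat \<Rightarrow> (nat \<Rightarrow> 'a :: field_char_0) \<Rightarrow> (nat \<Rightarrow> nat) \<Rightarrow> 'a" where
  "multinomial_term k x i =
     fact (\<Sum>j=1..k. i j) / (\<Prod>j=1..k. fact (i j)) * (\<Prod>j=1..k. x j ^ i j)"

lemma weighted_partitions_le:
  assumes "i \<in> weighted_partitions k m" "j \<in> {1..k}"
  shows "j * i j \<le> m"
proof -
  have "j * i j \<le> (\<Sum>j=1..k. j * i j)" using assms(2) by (intro member_le_sum) auto
  then show ?thesis using assms(1) by (simp add: weighted_partitions_def)
qed

lemma finite_weighted_partitions: "finite (weighted_partitions k m)"
proof (rule finite_subset)
  show "weighted_partitions k m \<subseteq> {1..k} \<rightarrow>\<^sub>E {..m}"
  proof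
    fix i assume i: "i \<in> weighted_partitions k m"
    have "i j \<le> m" if "j \<in> {1..k}" for j
    proof -
      have "i j \<le> j * i j" using that by simp
      with weighted_partitions_le[OF i that] show ?thesis by linarith
    qed
    with i show "i \<in> {1..k} \<rightarrow>\<^sub>E {..m}" by (auto simp: weighted_partitions_def PiE_def)
  qed
qed (simp add: finite_PiE)

lemma a_seq_eq_multinomial_sum:
  fixes s :: "nat \<Rightarrow> 'a :: field_char_0"
  assumes k: "k \<ge> 1"
  shows "a_seq k s m
    = (\<Sum>i\<in>weighted_partitions k m. multinomial_term k (\<lambda>j. (- 1) ^ (j - 1) * s j) i)"
proof -
  have ins: "{1..k} = insert 1 {2..k}" using k by auto
  define first where "first i = m - (\<Sum>j=2..k. j * i j)" for i :: "nat \<Rightarrow> nat"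
  show ?thesis
    unfolding a_seq_def
  proof (rule sum.reindex_bij_witness[where i = "\<lambda>i. restrict i {2..k}" and j = "\<lambda>i. i(1 := first i)"])
    fix i assume i: "i \<in> weighted_tuples k m"
    have le: "(\<Sum>j=2..k. j * i j) \<le> m" using i by (simp add: weighted_tuples_def)
    show "restrict (i(1 := first i)) {2..k} = i"
      using i by (auto simp: weighted_tuples_def PiE_def extensional_def)
    have "(\<Sum>j=1..k. j * (i(1 := first i)) j) = m"
      unfolding ins using le by (simp add: first_def)
    then show "i(1 := first i) \<in> weighted_partitions k m"
      using i k by (auto simp: weighted_partitions_def weighted_tuples_def PiE_def extensional_def)
    \<comment> \<open>Identifies the numerator of \<open>tuple_coeff\<close> as the factorial of the
      total of all exponents, the new coordinate \<open>first i\<close> included.\<close>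
    have "(\<Sum>j=2..k. j * i j) = (\<Sum>j=2..k. (j - 1) * i j) + (\<Sum>j=2..k. i j)"
      unfolding sum.distrib[symmetric] by (intro sum.cong) (auto simp: algebra_simps)
    then have "first i + (\<Sum>j=2..k. i j) = m - (\<Sum>j=2..k. (j - 1) * i j)"
      using le by (simp add: first_def)
    then show "multinomial_term k (\<lambda>j. (- 1) ^ (j - 1) * s j) (i(1 := first i))
      = tuple_coeff k i m * s 1 ^ (m - (\<Sum>j=2..k. j * i j))
        * (\<Prod>j=2..k. ((- 1) ^ (j - 1) * s j) ^ i j)"
      unfolding multinomial_term_def tuple_coeff_def ins first_def[symmetric] by (simp add: mult.commute mult.left_commute)
  next
    fix i assume i: "i \<in> weighted_partitions k m"
    have m: "i 1 + (\<Sum>j=2..k. j * i j) = m" using i unfolding weighted_partitions_def ins by simp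
    then show "restrict i {2..k} \<in> weighted_tuples k m"
      by (auto simp: weighted_tuples_def)
    have "first (restrict i {2..k}) = i 1" using m by (simp add: first_def)
    then show "(restrict i {2..k})(1 := first (restrict i {2..k})) = i"
      using i by (auto simp: weighted_partitions_def ins PiE_def extensional_def fun_eq_iff)
  qed
qed

text \<open>With \<open>N = (\<Sum>j. i j)\<close>, \<open>N! = (N - 1)! * (\<Sum>j. i j)\<close>, and each
  factor \<open>i j\<close> lowers the \<open>j\<close>-th exponent by one.\<close>
lemma multinomial_sum_rec:
  fixes x :: "nat \<Rightarrow> 'a :: field_char_0"
  assumes m: "m \<ge> 1"
  shows "(\<Sum>i\<in>weighted_partitions k m. multinomial_term k x i)
    = (\<Sum>j=1..min k m. x j * (\<Sum>i\<in>weighted_partitions k (m - j). multinomial_term k x i))"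
proof -
  \<comment> \<open>If \<open>multinomial_term k x i\<close> is read as a sum over words with
    \<open>i l\<close> letters \<open>l\<close>, then \<open>g j i\<close> is the part from words
    that begin with \<open>j\<close>.\<close>
  define g where "g j i = of_nat (i j) * (fact ((\<Sum>j=1..k. i j) - 1) / (\<Prod>j=1..k. fact (i j))
      * (\<Prod>j=1..k. x j ^ i j))" for j i
  have split_term: "multinomial_term k x i = (\<Sum>j=1..k. g j i)" if i: "i \<in> weighted_partitions k m" for i
  proof -
    have "0 < (\<Sum>j=1..k. i j)"
    proof (rule gr0I)
      assume "(\<Sum>j=1..k. i j) = 0"
      then have "\<forall>j\<in>{1..k}. i j = 0"
        by (simp only: sum_eq_0_iff[OF finite_atLeastAtMost])
      then have "(\<Sum>j=1..k. j * i j) = 0" by (intro sum.neutral) auto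
      with i m show False by (simp add: weighted_partitions_def)
    qed
    then have "(fact (\<Sum>j=1..k. i j) :: 'a) = of_nat (\<Sum>j=1..k. i j) * fact ((\<Sum>j=1..k. i j) - 1)"
      by (rule fact_reduce)
    then show ?thesis
      unfolding multinomial_term_def g_def sum_distrib_right[symmetric] by simp
  qed
  have lower: "(\<Sum>i\<in>weighted_partitions k m. g j i)
      = (if j \<le> m then x j * (\<Sum>i\<in>weighted_partitions k (m - j). multinomial_term k x i) else 0)"
    if j: "j \<in> {1..k}" for j
  proof (cases "j \<le> m")
    \<comment> \<open>A letter \<open>j > m\<close> cannot occur in weight \<open>m\<close>; this is
      the source of the bound \<open>min k m\<close>.\<close>
    case False
    have "g j i = 0" if "i \<in> weighted_partitions k m" for i
    proof -
      have "i j = 0" using weighted_partitions_le[OF that j] False by (cases "i j") auto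
      then show ?thesis by (simp add: g_def)
    qed
    with False show ?thesis by simp
  next
    case True
    have remove: "(\<Sum>l=1..k. f l) = f j + sum f ({1..k} - {j})"
      for f :: "nat \<Rightarrow> nat" using j by (intro sum.remove) auto
    have remove_prod: "(\<Prod>l=1..k. f l) = f j * prod f ({1..k} - {j})"
      for f :: "nat \<Rightarrow> 'a" using j by (intro prod.remove) auto
    \<comment> \<open>Only tuples with \<open>i j > 0\<close> contribute, and lowering
      \<open>i j\<close> by one maps them bijectively to the tuples of weight
      \<open>m - j\<close>.\<close>
    have "(\<Sum>i\<in>weighted_partitions k m. g j i) = (\<Sum>i\<in>{i \<in> weighted_partitions k m. i j > 0}. g j i)"
      by (intro sum.mono_neutral_right finite_weighted_partitions) (auto simp: g_def)
    also have "\<dots> = (\<Sum>i\<in>weighted_partitions k (m - j). x j * multinomial_term k x i)"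
    proof (rule sum.reindex_bij_witness[where i = "\<lambda>i. i(j := Suc (i j))" and j = "\<lambda>i. i(j := i j - 1)"])
      fix i assume i: "i \<in> {i \<in> weighted_partitions k m. i j > 0}"
      then show "(i(j := i j - 1))(j := Suc ((i(j := i j - 1)) j)) = i" by auto
      obtain p where p: "i j = Suc p" using i by (cases "i j") auto
      have "j * i j + (\<Sum>l\<in>{1..k} - {j}. l * i l) = m"
        using i remove[of "\<lambda>l. l * i l"] by (simp add: weighted_partitions_def)
      then have "(\<Sum>l=1..k. l * (i(j := i j - 1)) l) = m - j"
        by (subst remove) (simp add: p)
      then show "i(j := i j - 1) \<in> weighted_partitions k (m - j)"
        using i j by (auto simp: weighted_partitions_def PiE_def extensional_def)
      \<comment> \<open>\<open>R\<close> is common to both factorial products; what remains is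
        \<open>Suc p\<close>, which cancels the factor \<open>of_nat (i j)\<close> in
        \<open>g j i\<close>.\<close>
      define R where "R = prod (\<lambda>l. fact (i l) :: 'a) ({1..k} - {j})"
      have "R \<noteq> 0" by (simp add: R_def)
      have "(\<Prod>l=1..k. fact (i l)) = of_nat (Suc p) * fact p * R"
        "(\<Prod>l=1..k. fact ((i(j := i j - 1)) l)) = fact p * R"
        by (subst remove_prod; simp add: p R_def)+
      moreover have "(\<Prod>l=1..k. x l ^ i l) = x j * (\<Prod>l=1..k. x l ^ (i(j := i j - 1)) l)"
        by (subst (1 2) remove_prod) (simp add: p)
      moreover have "(\<Sum>l=1..k. i l) - 1 = (\<Sum>l=1..k. (i(j := i j - 1)) l)"
        by (subst (1 2) remove) (simp add: p)
      ultimately show "x j * multinomial_term k x (i(j := i j - 1)) = g j i"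
        using \<open>R \<noteq> 0\<close> unfolding multinomial_term_def g_def p
        by (simp add: divide_simps del: of_nat_Suc)
    next
      fix i assume i: "i \<in> weighted_partitions k (m - j)"
      show "(i(j := Suc (i j)))(j := (i(j := Suc (i j))) j - 1) = i" by auto
      have "j * i j + (\<Sum>l\<in>{1..k} - {j}. l * i l) = m - j"
        using i remove[of "\<lambda>l. l * i l"] by (simp add: weighted_partitions_def)
      then have "(\<Sum>l=1..k. l * (i(j := Suc (i j))) l) = m"
        using True by (subst remove) simp
      then show "i(j := Suc (i j)) \<in> {i \<in> weighted_partitions k m. i j > 0}"
        using i j by (auto simp: weighted_partitions_def PiE_def extensional_def)
    qed
    finally show ?thesis using True by (simp add: sum_distrib_left)
  qed
  have "(\<Sum>i\<in>weighted_partitions k m. multinomial_term k x i)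
      = (\<Sum>j=1..k. \<Sum>i\<in>weighted_partitions k m. g j i)"
    by (subst sum.swap) (simp add: split_term)
  also have "\<dots> = (\<Sum>j=1..k. if j \<le> m
      then x j * (\<Sum>i\<in>weighted_partitions k (m - j). multinomial_term k x i) else 0)"
    by (intro sum.cong refl lower)
  also have "\<dots> = (\<Sum>j=1..min k m. x j * (\<Sum>i\<in>weighted_partitions k (m - j). multinomial_term k x i))"
    by (intro sum.mono_neutral_cong_right) auto
  finally show ?thesis .
qed

section \<open>The sequence a as convolution inverse of the signed coefficients\<close>

lemma a_seq_0: "a_seq k s 0 = 1"
proof -
  have "weighted_tuples k 0 = {restrict (\<lambda>_. 0) {2..k}}"
    by (auto simp: weighted_tuples_def PiE_def extensional_def)
  then show ?thesis by (simp add: a_seq_def tuple_coeff_def)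
qed

text \<open>This is the multinomial recursion for x_j = (-1)^(j-1) s_j with all terms on one side:
  changing the sign turns x_j into (-1)^j s_j, and \<open>s 0 = 1\<close> makes
  \<open>a_seq k s m\<close> the summand for \<open>i = 0\<close>.\<close>

lemma a_seq_convolution:
  fixes s :: "nat \<Rightarrow> 'a :: field_char_0"
  assumes k: "k \<ge> 1" and s0: "s 0 = 1" and m: "m \<ge> 1"
  shows "(\<Sum>i\<le>min k m. (- 1) ^ i * s i * a_seq k s (m - i)) = 0"
proof -
  have "a_seq k s m = (\<Sum>j=1..min k m. (- 1) ^ (j - 1) * s j * a_seq k s (m - j))"
    using multinomial_sum_rec[OF m] by (simp add: a_seq_eq_multinomial_sum[OF k])
  moreover have "(\<Sum>j=1..min k m. (- 1) ^ (j - 1) * s j * a_seq k s (m - j))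
      = - (\<Sum>j=1..min k m. (- 1) ^ j * s j * a_seq k s (m - j))"
    unfolding sum_negf[symmetric]
  proof (intro sum.cong refl)
    fix j assume "j \<in> {1..min k m}"
    then show "(- 1) ^ (j - 1) * s j * a_seq k s (m - j) = - ((- 1) ^ j * s j * a_seq k s (m - j))"
      by (cases j) auto
  qed
  moreover have "(\<Sum>i\<le>min k m. (- 1) ^ i * s i * a_seq k s (m - i))
      = a_seq k s m + (\<Sum>i=1..min k m. (- 1) ^ i * s i * a_seq k s (m - i))"
    by (simp add: atMost_atLeast0 sum.atLeast_Suc_atMost s0)
  ultimately show ?thesis by simp
qed

section \<open>Expansion of the powers of \<open>A\<close>\<close>

theorem theorem2:
  fixes A :: "'a :: field_char_0 mat" and s :: "nat \<Rightarrow> 'a" and k n :: nat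
  assumes "k \<ge> 1"
    and "A \<in> carrier_mat k k"
    and "s 0 = 1"
    and "char_poly A = (\<Sum>i=0..k. monom ((-1) ^ i * s i) (k - i))"
    and "n \<ge> k"
  shows "A ^\<^sub>m n =
           finsum (module_mat TYPE('a) k k) (\<lambda>l. b_coeff k s n l \<cdot>\<^sub>m A ^\<^sub>m l) {0..k - 1}
         \<and> b_coeff k s n 0 = (-1) ^ (k - 1) * s k * a_seq k s (n - k)"
proof
  note k = assms(1) and A = assms(2) and s0 = assms(3) and char_poly = assms(4) and n = assms(5)
  let ?V = "module_mat TYPE('a) k k"
  define c where "c i = (- 1) ^ i * s i" for i
  interpret abelian_group ?V by (rule abelian_group_mat)
  have P: "A ^\<^sub>m t \<in> carrier_mat k k" for t using A by simp
  have conv: "(\<Sum>i\<le>min k m. c i * a_seq k s (m - i)) = 0" if "m \<ge> 1" for m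
    unfolding c_def by (rule a_seq_convolution[where s = s, OF k s0 that])
  have coeff: "coeff (char_poly A) (k - i) = c i" if "i \<le> k" for i
  proof -
    have "coeff (char_poly A) (k - i) = (\<Sum>l=0..k. if l = i then c l else 0)"
      unfolding char_poly coeff_sum using that by (intro sum.cong) (auto simp: c_def)
    then show ?thesis using that by simp
  qed
  show "A ^\<^sub>m n = finsum ?V (\<lambda>l. b_coeff k s n l \<cdot>\<^sub>m A ^\<^sub>m l) {0..k - 1}" (is "_ = ?S")
  proof (rule eq_matI)
    have "?S \<in> carrier ?V"
      by (rule finsum_closed) (use P in \<open>auto simp: module_mat_simps\<close>)
    then have S: "?S \<in> carrier_mat k k" by (simp add: module_mat_simps)
    show "dim_row (A ^\<^sub>m n) = dim_row ?S" "dim_col (A ^\<^sub>m n) = dim_col ?S"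
      using S P[of n] by auto
    fix r q assume "r < dim_row ?S" "q < dim_col ?S"
    then have rq: "r < k" "q < k" using S by auto
    define u where "u t = (A ^\<^sub>m t) $$ (r, q)" for t
    have u: "(\<Sum>i\<le>k. c i * u (N + k - i)) = 0" for N
    proof -
      \<comment> \<open>Since \<open>c i\<close> belongs to T^(k-i), reversing the order of
        summation gives Cayley-Hamilton multiplied by \<open>A ^\<^sub>m N\<close>.\<close>
      have "(\<Sum>i\<le>k. c i * u (N + k - i)) = (\<Sum>t\<le>k. coeff (char_poly A) t * u (N + t))"
        by (rule sum.reindex_bij_witness[where i = "\<lambda>t. k - t" and j = "\<lambda>t. k - t"])
          (auto simp: coeff)
      also have "\<dots> = 0"
        using cayley_hamilton_entry[OF A rq, of N] degree_monic_char_poly[OF A] by (simp add: u_def)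
      finally show ?thesis .
    qed
    \<comment> \<open>As \<open>n \<ge> k\<close>, the index on the left equals \<open>n\<close>; so
      the expansion is used with \<open>m = n - k + 1\<close>, the offset occurring in
      \<open>b_coeff\<close>.\<close>
    have "u (k - 1 + (n - k + 1))
        = (\<Sum>j<k. (\<Sum>i\<le>j. c i * a_seq k s (n - k + 1 + j - i)) * u (k - 1 - j))"
      by (rule linear_recurrence_expansion[OF k _ a_seq_0 conv u]) (simp_all add: c_def s0)
    also have "\<dots> = (\<Sum>l=0..k - 1. b_coeff k s n l * u l)"
      by (rule sum.reindex_bij_witness[where i = "\<lambda>t. k - 1 - t" and j = "\<lambda>t. k - 1 - t"])
        (use k in \<open>auto simp: b_coeff_def c_def atMost_atLeast0\<close>)
    also have "\<dots> = ?S $$ (r, q)"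
      using rq P carrier_matD[OF P] by (subst index_finsum_module_mat) (auto simp: u_def intro!: sum.cong)
    finally show "(A ^\<^sub>m n) $$ (r, q) = ?S $$ (r, q)"
      using k n by (simp add: u_def)
  qed
  \<comment> \<open>For \<open>l = 0\<close> one has \<open>j = k - 1\<close>, so the argument of
    \<open>a_seq\<close> becomes \<open>n - i\<close>: the sum is the vanishing convolution at
    \<open>n\<close> without its last summand \<open>i = k\<close>.\<close>
  have "b_coeff k s n 0 = (\<Sum>i<k. c i * a_seq k s (n - i))"
    unfolding b_coeff_def Let_def using k n by (intro sum.cong) (auto simp: c_def)
  also have "\<dots> = - (c k * a_seq k s (n - k))"
    using conv[of n] k n by (simp add: min_absorb1 lessThan_Suc_atMost[symmetric] eq_neg_iff_add_eq_0)
  also have "\<dots> = (- 1) ^ (k - 1) * s k * a_seq k s (n - k)"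
    using k by (cases k) (auto simp: c_def)
  finally show "b_coeff k s n 0 = (- 1) ^ (k - 1) * s k * a_seq k s (n - k)" .
qed

end
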